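(* The elements $D_{i}$ ($i>0$, $(i,10)=1$) are linearly independent over $\mathbb{Z}/2$. Consequently $pr$ induces a bijection from $N2/N1$ onto $W$.
   Context: All power series are in $\mathbb{Z}/2[[x]]$. Let $F=\sum_{n\ \mathrm{odd},\,n>0}x^{n^{2}}$, $G=F(x^{5})$, $D=\sum_{n>0,\ (n,10)=1}x^{n^{2}}$. For $k>0$, $(k,10)=1$, define $D_{1}=D$, $D_{3}=D^{8}/G$, $D_{7}=D^{2}G$, $D_{9}=D^{4}G$, $D_{k+10}=G^{2}D_{k}$; $W$ is the span of all $D_{k}$. $N2$ is the $\mathbb{Z}/2[G^{2}]$-submodule generated by $G,F,F^{2}G,F^{3},F^{4}G$, and $N1\subset N2$ is the $\mathbb{Z}/2[G^{2}]$-submodule generated by $G$. The map $pr:\mathbb{Z}/2[[x]]\to\mathbb{Z}/2[[x]]$ sends $\sum c_{n}x^{n}$ to $\sum_{(n,5)=1}c_{n}x^{n}$; it is $\mathbb{Z}/2[G]$-linear, kills $N1$, and maps $N2$ into $W$ (with $pr(F)=D_{1}$, $pr(F^{8}/G)=D_{3}$, $pr(F^{2}G)=D_{7}$, $pr(F^{4}G)=D_{9}$). *)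

theory Defs
  imports "HOL-Library.Z2" "HOL-Computational_Algebra.Formal_Power_Series"
begin

definition F :: "bit fps" where
  "F = Abs_fps (\<lambda>m. if \<exists>n. odd n \<and> n > 0 \<and> m = n^2 then 1 else 0)"

definition G :: "bit fps" where
  "G = Abs_fps (\<lambda>m. if 5 dvd m then fps_nth F (m div 5) else 0)"

definition D :: "bit fps" where
  "D = Abs_fps (\<lambda>m. if \<exists>n. n > 0 \<and> coprime n (10::nat) \<and> m = n^2 then 1 else 0)"

definition Dbase :: "nat \<Rightarrow> bit fps" where
  "Dbase r = (if r = 1 then D
              else if r = 3 then D^8 / G
              else if r = 7 then D^2 * G
              else if r = 9 then D^4 * G
              else 0)"

text \<open>D_k for k > 0, (k,10)=1, via D_{k+10} = G^2 D_k.\<close>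
definition Dk :: "nat \<Rightarrow> bit fps" where
  "Dk k = (G^2)^(k div 10) * Dbase (k mod 10)"

definition Kset :: "nat set" where
  "Kset = {k. k > 0 \<and> coprime k (10::nat)}"

definition W :: "bit fps set" where
  "W = {(\<Sum>k\<in>S. fps_const (c k) * Dk k) | S c. finite S \<and> S \<subseteq> Kset}"

definition ZG2 :: "bit fps set" where
  "ZG2 = {(\<Sum>i<n. fps_const (c i) * (G^2)^i) | n c. True}"

definition N2 :: "bit fps set" where
  "N2 = {a * G + b * F + c * (F^2 * G) + d * F^3 + e * (F^4 * G) | a b c d e.
           a \<in> ZG2 \<and> b \<in> ZG2 \<and> c \<in> ZG2 \<and> d \<in> ZG2 \<and> e \<in> ZG2}"

definition N1 :: "bit fps set" where
  "N1 = {a * G | a. a \<in> ZG2}"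

definition pr :: "bit fps \<Rightarrow> bit fps" where
  "pr f = Abs_fps (\<lambda>n. if coprime n (5::nat) then fps_nth f n else 0)"

end

theory Submission
  imports Defs "HOL-Library.Disjoint_Sets"
begin

text \<open>
  Each \<open>D\<^sub>k\<close> has order exactly \<open>k\<close>, so independence is immediate; the substance is that \<open>pr\<close> maps
  \<open>F\<^sup>3\<close> into \<open>W\<close>, which rests on the modular equation \<open>(F + G)\<^sup>6 = F G\<close>. With
  \<open>\<eta>(y) = \<Sum> y\<^bsup>a\<^sup>2\<^esup>\<close> over integers \<open>a \<equiv> 1 (mod 6)\<close>, it follows from
  \<open>\<eta>(y)\<^sup>3 = F(y\<^sup>3)\<close> and \<open>\<eta>(y) \<eta>(y\<^sup>5) = (F\<^sup>2 + G\<^sup>2)(y\<^sup>3)\<close>: cubing the second identity gives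
  \<open>(F + G)\<^sup>6 (y\<^sup>3) = (F G)(y\<^sup>3)\<close>. Squaring in characteristic 2 replaces \<open>y\<close> by \<open>y\<^sup>2\<close>, so both
  identities state the parity of the number of solutions of \<open>a\<^sup>2 + k b\<^sup>2 = n\<close> with
  \<open>a, b \<equiv> 1 (mod 6)\<close>, for \<open>k = 2\<close> and \<open>k = 5\<close>. That parity is found by pairing off solutions
  according to residues mod 3; the solutions not paired off lie on a coordinate axis or are
  those of the same problem with \<open>n\<close> replaced by \<open>n / 9\<close>.
\<close>

subsection \<open>Parity of representation numbers\<close>

text \<open>Keeps \<open>+\<close> and \<open>*\<close> on \<open>bit\<close> as ring operations;
  otherwise simp turns them into bitwise ones and \<open>algebra_simps\<close> loses its
  grip.\<close>

declare add_bit_eq_xor [simp del] mult_bit_eq_and [simp del]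

lemma bit_double [simp]: "(x::bit) + x = 0"
  by (cases x) simp_all

text \<open>Cardinality mod 2, encoded as a sum in \<open>bit\<close> so that splitting and
  reindexing of sums apply directly.\<close>

abbreviation par :: "'a set \<Rightarrow> bit" where
  "par S \<equiv> (\<Sum>p\<in>S. 1)"

lemma par_split: "finite S \<Longrightarrow> par S = par {p\<in>S. P p} + par {p\<in>S. \<not> P p}"
  by (subst sum.union_disjoint [symmetric]) (auto intro!: arg_cong [where f = card] arg_cong [where f = of_nat])

lemma par_split_mod_3:
  fixes f :: "'a \<Rightarrow> int"
  assumes "finite S"
  shows "par S = par {p\<in>S. f p mod 3 = 0} + par {p\<in>S. f p mod 3 = 1} + par {p\<in>S. f p mod 3 = 2}"
proof -
  have "{p\<in>S. f p mod 3 \<noteq> 0} = {p\<in>S. f p mod 3 = 1} \<union> {p\<in>S. f p mod 3 = 2}"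
    by auto
  then have "par {p\<in>S. f p mod 3 \<noteq> 0} = par {p\<in>S. f p mod 3 = 1} + par {p\<in>S. f p mod 3 = 2}"
    using assms by (simp only:) (rule sum.union_disjoint, auto)
  with par_split [OF assms, of "\<lambda>p. f p mod 3 = 0"] show ?thesis by (simp add: add.assoc)
qed

lemma par_split_zero:
  fixes f :: "'a \<Rightarrow> int"
  assumes "finite S"
  shows "par {p\<in>S. f p mod 3 = 0} = par {p\<in>S. f p = 0} + par {p\<in>S. f p \<noteq> 0 \<and> f p mod 3 = 0}"
proof -
  have "{p\<in>S. f p mod 3 = 0} = {p\<in>S. f p = 0} \<union> {p\<in>S. f p \<noteq> 0 \<and> f p mod 3 = 0}"
    by auto
  then show ?thesis
    using assms by (simp only:) (rule sum.union_disjoint, auto)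
qed

text \<open>Each pair \<open>{p, h p}\<close> contributes \<open>1 + 1 = 0\<close> in
  \<open>bit\<close>.\<close>

lemma par_involution:
  assumes "\<And>p. p \<in> S \<Longrightarrow> h p \<in> S" "\<And>p. p \<in> S \<Longrightarrow> h (h p) = p" "\<And>p. p \<in> S \<Longrightarrow> h p \<noteq> p"
  shows "par S = 0"
  by (rule sum_involution_eq_0 [where h = h]) (use assms in auto)

lemma par_bij_witness:
  assumes "\<And>p. p \<in> S \<Longrightarrow> j (i p) = p" "\<And>p. p \<in> S \<Longrightarrow> i p \<in> T"
    "\<And>q. q \<in> T \<Longrightarrow> i (j q) = q" "\<And>q. q \<in> T \<Longrightarrow> j q \<in> S"
  shows "par S = par T"
  by (rule sum.reindex_bij_witness [where i = j and j = i]) (use assms in auto)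

section \<open>Finiteness of the solution sets, and solutions on a coordinate axis\<close>

lemma int_square_bound:
  fixes x :: int
  assumes "x\<^sup>2 \<le> n"
  shows "x \<in> {-n..n}"
proof -
  have "\<bar>x\<bar> \<le> x\<^sup>2"
    using self_le_power [of "\<bar>x\<bar>" 2] by (cases "x = 0") auto
  then show ?thesis using assms by auto
qed

lemma finite_quadratic_form:
  fixes n :: int
  assumes "k > 0"
  shows "finite {(x::int, y). x\<^sup>2 + k * y\<^sup>2 = n}"
proof (rule finite_subset)
  show "{(x::int, y). x\<^sup>2 + k * y\<^sup>2 = n} \<subseteq> {-n..n} \<times> {-n..n}"
  proof safe
    fix x y :: int
    assume eq: "n = x\<^sup>2 + k * y\<^sup>2"
    have "k * y\<^sup>2 \<ge> 0" "y\<^sup>2 \<le> k * y\<^sup>2"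
      using assms mult_right_mono [of 1 k "y\<^sup>2"] by auto
    then have "x\<^sup>2 \<le> n" "y\<^sup>2 \<le> n" using eq zero_le_power2 [of x] by linarith+
    then show "x \<in> {-(x\<^sup>2 + k * y\<^sup>2)..x\<^sup>2 + k * y\<^sup>2}" "y \<in> {-(x\<^sup>2 + k * y\<^sup>2)..x\<^sup>2 + k * y\<^sup>2}"
      unfolding eq [symmetric] by (simp_all only: int_square_bound)
  qed
qed simp

text \<open>Of the two roots \<open>n\<close> and \<open>-n\<close> of a square prime to 3, exactly
  one is 1 mod 3. This evaluates the contribution of an axis.\<close>

lemma par_sqrt:
  "par {x::int. x\<^sup>2 = int N \<and> odd x \<and> x mod 3 = 1} = of_bool (\<exists>n. odd n \<and> \<not> 3 dvd n \<and> N = n\<^sup>2)"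
  (is "par ?S = _")
proof (cases "\<exists>n. odd n \<and> \<not> 3 dvd n \<and> N = n\<^sup>2")
  case True
  then obtain n where n: "odd n" "\<not> 3 dvd n" "N = n\<^sup>2" by blast
  define y where "y = (if n mod 3 = 1 then int n else - int n)"
  have y: "y mod 3 = 1" "odd y" "y\<^sup>2 = int N"
    unfolding y_def using n by (auto; presburger)+
  have "?S = {y}"
  proof safe
    fix x :: int
    assume x: "x\<^sup>2 = int N" "x mod 3 = 1"
    then have "x = y \<or> x = -y" using y by (metis power2_eq_iff)
    then show "x = y" using x y by presburger
  qed (use y in auto)
  then show ?thesis using True by simp
next
  case False
  have "?S = {}"
  proof (rule ccontr)
    assume "?S \<noteq> {}"
    then obtain x :: int where x: "x\<^sup>2 = int N" "odd x" "x mod 3 = 1" by blast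
    have "odd (nat \<bar>x\<bar>)" "\<not> 3 dvd nat \<bar>x\<bar>" using x(2,3) by (auto; presburger)+
    moreover have "N = (nat \<bar>x\<bar>)\<^sup>2"
      using x(1) by (metis nat_int nat_power_eq abs_ge_zero power2_abs)
    ultimately show False using False by blast
  qed
  with False show ?thesis by (simp only: sum.empty of_bool_eq)
qed

text \<open>
  \<open>a = c + 4 v\<close>, \<open>b = c - 2 v\<close> turns \<open>c\<^sup>2 + 8 v\<^sup>2 = N\<close> into \<open>a\<^sup>2 + 2 b\<^sup>2 = 3 N\<close>, and the congruence
  conditions below into \<open>a \<equiv> b \<equiv> 1 (mod 6)\<close>. Likewise \<open>a = c - 5 w\<close>, \<open>b = c + w\<close> turns
  \<open>c\<^sup>2 + 5 w\<^sup>2 = N\<close> into \<open>a\<^sup>2 + 5 b\<^sup>2 = 6 N\<close>.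
\<close>

definition reps_8 :: "nat \<Rightarrow> (int \<times> int) set" where
  "reps_8 N = {(c, v). c\<^sup>2 + 8 * v\<^sup>2 = int N \<and> odd c \<and> (c + v) mod 3 = 1}"

definition reps_5 :: "nat \<Rightarrow> (int \<times> int) set" where
  "reps_5 N = {(c, w). c\<^sup>2 + 5 * w\<^sup>2 = int N \<and> odd (c + w) \<and> (c + w) mod 3 = 1}"

section \<open>Descent from \<open>N\<close> to \<open>N / 9\<close>\<close>

lemma finite_reps_8: "finite (reps_8 N)"
  by (rule finite_subset [OF _ finite_quadratic_form [of 8 "int N"]]) (auto simp: reps_8_def)

lemma finite_reps_5: "finite (reps_5 N)"
  by (rule finite_subset [OF _ finite_quadratic_form [of 5 "int N"]]) (auto simp: reps_5_def)

text \<open>The condition on \<open>c + v\<close> leaves three classes, by \<open>v mod 3\<close>.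
  Class 0 pairs off under \<open>v -> -v\<close> except on the axis \<open>v = 0\<close>; class 1
  has 3 dividing \<open>c\<close> and pairs off under \<open>c -> -c\<close>, where \<open>c\<close>
  odd excludes a fixed point; class 2 is rewritten as \<open>T\<close>. In \<open>T\<close> only the
  pairs with 3 dividing \<open>t\<close> survive, and these are the solutions for
  \<open>N div 9\<close>.\<close>

lemma par_reps_8_rec:
  "par (reps_8 N) = of_bool (\<exists>n. odd n \<and> \<not> 3 dvd n \<and> N = n\<^sup>2) + (if 9 dvd N then par (reps_8 (N div 9)) else 0)"
proof -
  (* Solutions with both coordinates congruent to 2 mod 3, negated and with the first
     coordinate written as v + 3 t. *)
  define T where "T = {(v::int, t::int). 9 * v\<^sup>2 + 6 * v * t + 9 * t\<^sup>2 = int N \<and> v mod 3 = 1 \<and> odd (v + t)}"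
  have 0: "par {p \<in> reps_8 N. snd p = 0} = of_bool (\<exists>n. odd n \<and> \<not> 3 dvd n \<and> N = n\<^sup>2)"
    unfolding par_sqrt [symmetric]
    by (rule par_bij_witness [where i = fst and j = "\<lambda>x. (x, 0)"]) (auto simp: reps_8_def)
  have 1: "par {p \<in> reps_8 N. snd p \<noteq> 0 \<and> snd p mod 3 = 0} = 0"
    by (rule par_involution [where h = "\<lambda>(c, v). (c, -v)"]) (auto simp: reps_8_def; presburger)+
  have 2: "par {p \<in> reps_8 N. fst p mod 3 = 0} = 0"
    by (rule par_involution [where h = "\<lambda>(c, v). (-c, v)"]) (auto simp: reps_8_def; presburger)+
  have 3: "par {p \<in> reps_8 N. snd p mod 3 = 2} = par T"
  proof (rule par_bij_witness [where i = "\<lambda>(c, v). (-v, (v - c) div 3)" and j = "\<lambda>(v, t). (- v - 3 * t, - v)"])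
    fix p assume "p \<in> {p \<in> reps_8 N. snd p mod 3 = 2}"
    then obtain c v where p: "p = (c, v)" "c\<^sup>2 + 8 * v\<^sup>2 = int N" "odd c" "(c + v) mod 3 = 1" "v mod 3 = 2"
      by (cases p) (auto simp: reps_8_def)
    define t where "t = (v - c) div 3"
    have c: "c = v - 3 * t" unfolding t_def using p by presburger
    show "(\<lambda>(v, t). (- v - 3 * t, - v)) ((\<lambda>(c, v). (-v, (v - c) div 3)) p) = p"
      using c by (simp add: p(1) flip: t_def)
    have "odd (- v + t)" "(- v) mod 3 = 1" using p c by presburger+
    moreover have "9 * (- v)\<^sup>2 + 6 * (- v) * t + 9 * t\<^sup>2 = int N"
      using p(2) unfolding c by (simp add: power2_eq_square algebra_simps)
    ultimately show "(\<lambda>(c, v). (-v, (v - c) div 3)) p \<in> T"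
      by (simp add: p(1) T_def flip: t_def)
  next
    fix q assume "q \<in> T"
    then obtain v t where q: "q = (v, t)" "9 * v\<^sup>2 + 6 * v * t + 9 * t\<^sup>2 = int N" "v mod 3 = 1" "odd (v + t)"
      by (cases q) (auto simp: T_def)
    show "(\<lambda>(c, v). (-v, (v - c) div 3)) ((\<lambda>(v, t). (- v - 3 * t, - v)) q) = q"
      by (simp add: q(1))
    have "odd (- v - 3 * t)" "(- v - 3 * t + - v) mod 3 = 1" "(- v) mod 3 = 2" using q by presburger+
    moreover have "(- v - 3 * t)\<^sup>2 + 8 * (- v)\<^sup>2 = int N"
      using q(2) by (simp add: power2_eq_square algebra_simps)
    ultimately show "(\<lambda>(v, t). (- v - 3 * t, - v)) q \<in> {p \<in> reps_8 N. snd p mod 3 = 2}"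
      by (simp add: q(1) reps_8_def)
  qed
  \<comment> \<open>The form in \<open>T\<close> is symmetric in \<open>v\<close> and
    \<open>t\<close> and under a common sign change. Fixed points of this swap and of the next one
    would make \<open>v + t\<close> even.\<close>
  have 4: "par {p \<in> T. snd p mod 3 = 1} = 0"
    by (rule par_involution [where h = "\<lambda>(v, t). (t, v)"]) (auto simp: T_def algebra_simps)
  have 5: "par {p \<in> T. snd p mod 3 = 2} = 0"
    by (rule par_involution [where h = "\<lambda>(v, t). (-t, -v)"]) (auto simp: T_def algebra_simps; presburger)+
  have 6: "par {p \<in> T. snd p mod 3 = 0} = (if 9 dvd N then par (reps_8 (N div 9)) else 0)"
  proof (cases "9 dvd N")
    case True
    then obtain M where M: "N = 9 * M" by blast
    have "par {p \<in> T. snd p mod 3 = 0} = par (reps_8 M)"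
    \<comment> \<open>With \<open>t = 3 u\<close> the form is \<open>9 ((v + u)^2 + 8 u^2)\<close>,
      which suggests \<open>c = v + u\<close>, \<open>w = -u\<close>.\<close>
    proof (rule par_bij_witness [where i = "\<lambda>(v, t). (v + t div 3, - (t div 3))" and j = "\<lambda>(c, w). (c + w, -3 * w)"])
      fix p assume "p \<in> {p \<in> T. snd p mod 3 = 0}"
      then obtain v t where p: "p = (v, t)" "9 * v\<^sup>2 + 6 * v * t + 9 * t\<^sup>2 = int N" "v mod 3 = 1" "odd (v + t)" "t mod 3 = 0"
        by (cases p) (auto simp: T_def)
      then obtain u where u: "t = 3 * u" by (metis mod_0_imp_dvd dvdE)
      show "(\<lambda>(c, w). (c + w, -3 * w)) ((\<lambda>(v, t). (v + t div 3, - (t div 3))) p) = p"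
        by (simp add: p(1) u)
      have "odd (v + u)" "(v + u + - u) mod 3 = 1" using p u by presburger+
      moreover have "(v + u)\<^sup>2 + 8 * (- u)\<^sup>2 = int M"
        using p(2) unfolding u M by (simp add: power2_eq_square algebra_simps)
      ultimately show "(\<lambda>(v, t). (v + t div 3, - (t div 3))) p \<in> reps_8 M"
        by (simp add: p(1) u reps_8_def)
    next
      fix q assume "q \<in> reps_8 M"
      then obtain c w where q: "q = (c, w)" "c\<^sup>2 + 8 * w\<^sup>2 = int M" "odd c" "(c + w) mod 3 = 1"
        by (cases q) (auto simp: reps_8_def)
      show "(\<lambda>(v, t). (v + t div 3, - (t div 3))) ((\<lambda>(c, w). (c + w, -3 * w)) q) = q"
        by (simp add: q(1); presburger)
      have "odd (c + w + -3 * w)" "(-3 * w) mod 3 = 0" using q by presburger+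
      moreover have "9 * (c + w)\<^sup>2 + 6 * (c + w) * (-3 * w) + 9 * (-3 * w)\<^sup>2 = int N"
        using q(2) unfolding M by (simp add: power2_eq_square algebra_simps)
      ultimately show "(\<lambda>(c, w). (c + w, -3 * w)) q \<in> {p \<in> T. snd p mod 3 = 0}"
        using q(4) by (simp add: q(1) T_def)
    qed
    then show ?thesis using M by simp
  next
    case False
    have "{p \<in> T. snd p mod 3 = 0} = {}"
    proof (rule ccontr)
      assume "{p \<in> T. snd p mod 3 = 0} \<noteq> {}"
      then obtain v t where p: "9 * v\<^sup>2 + 6 * v * t + 9 * t\<^sup>2 = int N" "t mod 3 = 0"
        unfolding T_def by fastforce
      then obtain u where u: "t = 3 * u" by (metis mod_0_imp_dvd dvdE)
      have "int N = 9 * (v\<^sup>2 + 2 * v * u + 9 * u\<^sup>2)"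
        using p(1) unfolding u by (simp add: power2_eq_square algebra_simps)
      then have "9 dvd int N" by simp
      with False show False by presburger
    qed
    with False show ?thesis by (simp only: sum.empty if_False)
  qed
  \<comment> \<open>Finiteness is pulled back along the injective map that served as inverse in fact
    \<open>3\<close>.\<close>
  have "T \<subseteq> (\<lambda>(v, t). (- v - 3 * t, - v)) -` {(c, v). c\<^sup>2 + 8 * v\<^sup>2 = int N}"
    by (auto simp: T_def power2_eq_square algebra_simps)
  then have "finite T"
    by (rule finite_subset) (rule finite_vimageI [OF finite_quadratic_form], auto simp: inj_def)
  from par_split_mod_3 [OF this, of snd]
  have T: "par T = (if 9 dvd N then par (reps_8 (N div 9)) else 0)"
    unfolding 4 5 6 by simp
  have "par {p \<in> reps_8 N. snd p mod 3 = 0} = par {p \<in> reps_8 N. snd p = 0} + par {p \<in> reps_8 N. snd p \<noteq> 0 \<and> snd p mod 3 = 0}"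
    by (rule par_split_zero [OF finite_reps_8])
  \<comment> \<open>As \<open>c + v\<close> is 1 mod 3, \<open>v\<close> is 1 mod 3 exactly when 3
    divides \<open>c\<close>; so fact \<open>2\<close> disposes of this class.\<close>
  moreover have "{p \<in> reps_8 N. snd p mod 3 = 1} = {p \<in> reps_8 N. fst p mod 3 = 0}"
    by (auto simp: reps_8_def; presburger)
  ultimately show ?thesis
    using par_split_mod_3 [OF finite_reps_8 [of N], of snd] 0 1 2 3 T by simp
qed

text \<open>The same three classes by \<open>w mod 3\<close>. Both axes now contribute, which gives
  the two \<open>of_bool\<close> terms. In class 2, writing the negated first coordinate as
  \<open>w + 3 t\<close> with \<open>w\<close> the negated second one yields \<open>T\<close>; here
  the class of \<open>t\<close> equal to 2 mod 3 survives.\<close>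

lemma par_reps_5_rec:
  "par (reps_5 N) = of_bool (\<exists>n. odd n \<and> \<not> 3 dvd n \<and> N = n\<^sup>2) + of_bool (\<exists>n. odd n \<and> \<not> 3 dvd n \<and> N = 5 * n\<^sup>2)
     + (if 9 dvd N then par (reps_5 (N div 9)) else 0)"
proof -
  define T where "T = {(w::int, t::int). 6 * w\<^sup>2 + 6 * w * t + 9 * t\<^sup>2 = int N \<and> w mod 3 = 1 \<and> odd t}"
  have 0: "par {p \<in> reps_5 N. snd p = 0} = of_bool (\<exists>n. odd n \<and> \<not> 3 dvd n \<and> N = n\<^sup>2)"
    unfolding par_sqrt [symmetric]
    by (rule par_bij_witness [where i = fst and j = "\<lambda>x. (x, 0)"]) (auto simp: reps_5_def)
  have 1: "par {p \<in> reps_5 N. snd p \<noteq> 0 \<and> snd p mod 3 = 0} = 0"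
    by (rule par_involution [where h = "\<lambda>(c, w). (c, -w)"]) (auto simp: reps_5_def; presburger)+
  \<comment> \<open>Unlike in \<open>reps_8\<close>, \<open>c\<close> may be even, so
    \<open>c = 0\<close> is left over by \<open>c -> -c\<close> and gives
    \<open>N = 5 w^2\<close>.\<close>
  have 2: "par {p \<in> reps_5 N. fst p = 0} = of_bool (\<exists>n. odd n \<and> \<not> 3 dvd n \<and> N = 5 * n\<^sup>2)"
  proof (cases "5 dvd N")
    case True
    then obtain M where M: "N = 5 * M" by blast
    have "par {p \<in> reps_5 N. fst p = 0} = par {x. x\<^sup>2 = int M \<and> odd x \<and> x mod 3 = 1}"
      by (rule par_bij_witness [where i = snd and j = "\<lambda>x. (0, x)"]) (auto simp: reps_5_def M)
    then show ?thesis by (simp only: par_sqrt) (simp add: M)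
  next
    case False
    have "5 dvd int N" if "5 * w\<^sup>2 = int N" for w
      using that by (metis dvd_triv_left)
    moreover have "\<not> 5 dvd int N" using False by presburger
    ultimately have "{p \<in> reps_5 N. fst p = 0} = {}" by (auto simp: reps_5_def)
    moreover have "\<not> (\<exists>n. odd n \<and> \<not> 3 dvd n \<and> N = 5 * n\<^sup>2)" using False by auto
    ultimately show ?thesis by (simp only: sum.empty of_bool_eq)
  qed
  have 7: "par {p \<in> reps_5 N. fst p \<noteq> 0 \<and> fst p mod 3 = 0} = 0"
    by (rule par_involution [where h = "\<lambda>(c, w). (-c, w)"]) (auto simp: reps_5_def; presburger)+
  have 3: "par {p \<in> reps_5 N. snd p mod 3 = 2} = par T"
  proof (rule par_bij_witness [where i = "\<lambda>(c, w). (-w, (w - c) div 3)" and j = "\<lambda>(w, t). (- w - 3 * t, - w)"])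
    fix p assume "p \<in> {p \<in> reps_5 N. snd p mod 3 = 2}"
    then obtain c w where p: "p = (c, w)" "c\<^sup>2 + 5 * w\<^sup>2 = int N" "odd (c + w)" "(c + w) mod 3 = 1" "w mod 3 = 2"
      by (cases p) (auto simp: reps_5_def)
    define t where "t = (w - c) div 3"
    have c: "c = w - 3 * t" unfolding t_def using p by presburger
    show "(\<lambda>(w, t). (- w - 3 * t, - w)) ((\<lambda>(c, w). (-w, (w - c) div 3)) p) = p"
      using c by (simp add: p(1) flip: t_def)
    have "odd t" "(- w) mod 3 = 1" using p c by presburger+
    moreover have "6 * (- w)\<^sup>2 + 6 * (- w) * t + 9 * t\<^sup>2 = int N"
      using p(2) unfolding c by (simp add: power2_eq_square algebra_simps)
    ultimately show "(\<lambda>(c, w). (-w, (w - c) div 3)) p \<in> T"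
      by (simp add: p(1) T_def flip: t_def)
  next
    fix q assume "q \<in> T"
    then obtain w t where q: "q = (w, t)" "6 * w\<^sup>2 + 6 * w * t + 9 * t\<^sup>2 = int N" "w mod 3 = 1" "odd t"
      by (cases q) (auto simp: T_def)
    show "(\<lambda>(c, w). (-w, (w - c) div 3)) ((\<lambda>(w, t). (- w - 3 * t, - w)) q) = q"
      by (simp add: q(1))
    have "odd (- w - 3 * t + - w)" "(- w - 3 * t + - w) mod 3 = 1" "(- w) mod 3 = 2" using q by presburger+
    moreover have "(- w - 3 * t)\<^sup>2 + 5 * (- w)\<^sup>2 = int N"
      using q(2) by (simp add: power2_eq_square algebra_simps)
    ultimately show "(\<lambda>(w, t). (- w - 3 * t, - w)) q \<in> {p \<in> reps_5 N. snd p mod 3 = 2}"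
      by (simp add: q(1) reps_5_def)
  qed
  \<comment> \<open>The form is \<open>6 w (w + t) + 9 t^2\<close>, invariant under
    \<open>w -> -w - t\<close>; a fixed point would have \<open>t = -2 w\<close>, against
    \<open>t\<close> odd.\<close>
  have 4: "par {p \<in> T. snd p mod 3 = 1} = 0"
    by (rule par_involution [where h = "\<lambda>(w, t). (- w - t, t)"])
      (auto simp: T_def power2_eq_square algebra_simps; presburger)+
  \<comment> \<open>The previous map composed with a sign change of both coordinates; a fixed point
    would have \<open>t = 0\<close>, again even.\<close>
  have 5: "par {p \<in> T. snd p mod 3 = 0} = 0"
    by (rule par_involution [where h = "\<lambda>(w, t). (w + t, - t)"])
      (auto simp: T_def power2_eq_square algebra_simps; presburger)+
  (* Substituting t = 3 u - w leads back to the original form. *)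
  have form: "6 * w\<^sup>2 + 6 * w * (3 * u - w) + 9 * (3 * u - w)\<^sup>2 = 9 * ((w - 2 * u)\<^sup>2 + 5 * (- u)\<^sup>2)" for w u :: int
    by (simp add: power2_eq_square algebra_simps)
  have 6: "par {p \<in> T. snd p mod 3 = 2} = (if 9 dvd N then par (reps_5 (N div 9)) else 0)"
  proof (cases "9 dvd N")
    case True
    then obtain M where M: "N = 9 * M" by blast
    have "par {p \<in> T. snd p mod 3 = 2} = par (reps_5 M)"
    \<comment> \<open>With \<open>u = (w + t) / 3\<close>, the identity \<open>form\<close> suggests
      \<open>s = w - 2 u\<close>, \<open>x = -u\<close>; solving for \<open>w\<close> and
      \<open>t\<close> gives the inverse.\<close>
    proof (rule par_bij_witness [where i = "\<lambda>(w, t). (w - 2 * ((w + t) div 3), - ((w + t) div 3))"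
          and j = "\<lambda>(s, x). (s - 2 * x, - x - s)"])
      fix p assume "p \<in> {p \<in> T. snd p mod 3 = 2}"
      then obtain w t where p: "p = (w, t)" "6 * w\<^sup>2 + 6 * w * t + 9 * t\<^sup>2 = int N" "w mod 3 = 1" "odd t" "t mod 3 = 2"
        by (cases p) (auto simp: T_def)
      define u where "u = (w + t) div 3"
      have t: "t = 3 * u - w" unfolding u_def using p by presburger
      show "(\<lambda>(s, x). (s - 2 * x, - x - s)) ((\<lambda>(w, t). (w - 2 * ((w + t) div 3), - ((w + t) div 3))) p) = p"
        by (simp add: p(1) t)
      have "odd (w - 2 * u + - u)" "(w - 2 * u + - u) mod 3 = 1" using p t by presburger+
      moreover have "(w - 2 * u)\<^sup>2 + 5 * (- u)\<^sup>2 = int M"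
        using p(2) unfolding t M form by simp
      ultimately show "(\<lambda>(w, t). (w - 2 * ((w + t) div 3), - ((w + t) div 3))) p \<in> reps_5 M"
        by (simp add: p(1) reps_5_def flip: u_def)
    next
      fix q assume "q \<in> reps_5 M"
      then obtain s x where q: "q = (s, x)" "s\<^sup>2 + 5 * x\<^sup>2 = int M" "odd (s + x)" "(s + x) mod 3 = 1"
        by (cases q) (auto simp: reps_5_def)
      show "(\<lambda>(w, t). (w - 2 * ((w + t) div 3), - ((w + t) div 3))) ((\<lambda>(s, x). (s - 2 * x, - x - s)) q) = q"
        by (simp add: q(1); presburger)
      have "odd (- x - s)" "(- x - s) mod 3 = 2" "(s - 2 * x) mod 3 = 1" using q by presburger+
      moreover have "6 * (s - 2 * x)\<^sup>2 + 6 * (s - 2 * x) * (- x - s) + 9 * (- x - s)\<^sup>2 = int N"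
        using q(2) form [of "s - 2 * x" "- x"] unfolding M by simp
      ultimately show "(\<lambda>(s, x). (s - 2 * x, - x - s)) q \<in> {p \<in> T. snd p mod 3 = 2}"
        by (simp add: q(1) T_def)
    qed
    then show ?thesis using M by simp
  next
    case False
    have "{p \<in> T. snd p mod 3 = 2} = {}"
    proof (rule ccontr)
      assume "{p \<in> T. snd p mod 3 = 2} \<noteq> {}"
      then obtain w t where p: "6 * w\<^sup>2 + 6 * w * t + 9 * t\<^sup>2 = int N" "w mod 3 = 1" "t mod 3 = 2"
        unfolding T_def by fastforce
      define u where "u = (w + t) div 3"
      have t: "t = 3 * u - w" unfolding u_def using p by presburger
      have "9 dvd int N" using p(1) unfolding t form by (metis dvd_triv_left)
      with False show False by presburger
    qed
    with False show ?thesis by (simp only: sum.empty if_False)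
  qed
  have "T \<subseteq> (\<lambda>(w, t). (- w - 3 * t, - w)) -` {(c, w). c\<^sup>2 + 5 * w\<^sup>2 = int N}"
    by (auto simp: T_def power2_eq_square algebra_simps)
  then have "finite T"
    by (rule finite_subset) (rule finite_vimageI [OF finite_quadratic_form], auto simp: inj_def)
  from par_split_mod_3 [OF this, of snd]
  have T: "par T = (if 9 dvd N then par (reps_5 (N div 9)) else 0)"
    unfolding 4 5 6 by simp
  have "par {p \<in> reps_5 N. snd p mod 3 = 0} = par {p \<in> reps_5 N. snd p = 0} + par {p \<in> reps_5 N. snd p \<noteq> 0 \<and> snd p mod 3 = 0}"
    by (rule par_split_zero [OF finite_reps_5])
  moreover have "par {p \<in> reps_5 N. fst p mod 3 = 0} = par {p \<in> reps_5 N. fst p = 0} + par {p \<in> reps_5 N. fst p \<noteq> 0 \<and> fst p mod 3 = 0}"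
    by (rule par_split_zero [OF finite_reps_5])
  moreover have "{p \<in> reps_5 N. snd p mod 3 = 1} = {p \<in> reps_5 N. fst p mod 3 = 0}"
    by (auto simp: reps_5_def; presburger)
  ultimately show ?thesis
    using par_split_mod_3 [OF finite_reps_5 [of N], of snd] 0 1 2 3 7 T by simp
qed

text \<open>Splits on whether 3 divides \<open>n\<close>. Since 9 does not divide \<open>k\<close>,
  the two cases exclude each other (\<open>N\<close> prime to 9-divisibility in the first), so the
  disjunction is a sum in \<open>bit\<close>. This is the recursion of \<open>par_reps_8_rec\<close>
  and \<open>par_reps_5_rec\<close> for the closed forms.\<close>

lemma of_bool_odd_square_rec:
  fixes k N :: nat
  assumes "\<not> 9 dvd k"
  shows "of_bool (\<exists>n. odd n \<and> N = k * n\<^sup>2) =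
    of_bool (\<exists>n. odd n \<and> \<not> 3 dvd n \<and> N = k * n\<^sup>2)
      + (if 9 dvd N then of_bool (\<exists>n. odd n \<and> N div 9 = k * n\<^sup>2) else (0::bit))"
proof -
  have "\<not> 9 dvd N" if "\<not> 3 dvd n" "N = k * n\<^sup>2" for n
  proof -
    have "coprime 9 (n\<^sup>2)"
      using that(1) prime_imp_coprime_nat [of 3 n] coprime_power_left_iff [of 3 2 "n\<^sup>2"] by simp
    with that(2) assms show ?thesis by (simp add: coprime_dvd_mult_left_iff)
  qed
  moreover have "(\<exists>n. odd n \<and> N = k * n\<^sup>2) \<longleftrightarrow>
    (\<exists>n. odd n \<and> \<not> 3 dvd n \<and> N = k * n\<^sup>2) \<or> (9 dvd N \<and> (\<exists>n. odd n \<and> N div 9 = k * n\<^sup>2))"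
    (is "?L \<longleftrightarrow> ?R")
  proof
    assume ?L
    then obtain n where n: "odd n" "N = k * n\<^sup>2" by blast
    show ?R
    proof (cases "3 dvd n")
      case True
      then obtain m where m: "n = 3 * m" by blast
      have "N = 9 * (k * m\<^sup>2)" "odd m" using n m by (auto simp: power2_eq_square)
      then show ?thesis by auto
    qed (use n in blast)
  next
    assume ?R
    then show ?L
    proof
      assume "9 dvd N \<and> (\<exists>n. odd n \<and> N div 9 = k * n\<^sup>2)"
      then obtain n where "odd n" "N = 9 * (k * n\<^sup>2)" by (metis dvd_mult_div_cancel)
      then have "odd (3 * n)" "N = k * (3 * n)\<^sup>2" by (auto simp: power2_eq_square)
      then show ?L by blast
    qed blast
  qed
  ultimately show ?thesis by auto
qed

text \<open>Both sides obey the same recursion from \<open>N\<close> to \<open>N div 9\<close>. It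
  stops descending at \<open>N = 0\<close>, where parity rules out the solution
  \<open>(0, 0)\<close>.\<close>

lemma par_reps_8: "par (reps_8 N) = of_bool (\<exists>n. odd n \<and> N = n\<^sup>2)"
proof (induction N rule: less_induct)
  case (less N)
  show ?case
  proof (cases "N = 0")
    case True
    have "reps_8 0 = {}" by (auto simp: reps_8_def add_nonneg_eq_0_iff)
    with True show ?thesis by auto
  next
    case False
    then show ?thesis
      using of_bool_odd_square_rec [of 1 N] par_reps_8_rec [of N] less [of "N div 9"] by simp
  qed
qed

text \<open>As for \<open>reps_8\<close>; the two axis terms are matched by
  \<open>of_bool_odd_square_rec\<close> with \<open>k = 1\<close> and \<open>k = 5\<close>.\<close>

lemma par_reps_5: "par (reps_5 N) = of_bool (\<exists>n. odd n \<and> N = n\<^sup>2) + of_bool (\<exists>n. odd n \<and> N = 5 * n\<^sup>2)"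
proof (induction N rule: less_induct)
  case (less N)
  show ?case
  proof (cases "N = 0")
    case True
    have "reps_5 0 = {}" by (auto simp: reps_5_def add_nonneg_eq_0_iff)
    with True show ?thesis by auto
  next
    case False
    then show ?thesis
      using of_bool_odd_square_rec [of 1 N] of_bool_odd_square_rec [of 5 N] par_reps_5_rec [of N] less [of "N div 9"]
      by (simp add: ac_simps)
  qed
qed

subsection \<open>The modular equation\<close>

unbundle fps_syntax

section \<open>Substitution and squaring of power series over Z/2\<close>

lemma fps_compose_X_power_nth:
  assumes "k > 0"
  shows "(f oo fps_X ^ k) $ n = (if k dvd n then f $ (n div k) else (0::bit))"
proof -
  have "(f oo fps_X ^ k) $ n = (\<Sum>i=0..n. if n = k * i then f $ i else 0)"
    unfolding fps_compose_nth by (intro sum.cong refl) (simp flip: power_mult)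
  also have "\<dots> = (\<Sum>i=0..n. if i = n div k then (if k dvd n then f $ (n div k) else 0) else 0)"
    using assms by (intro sum.cong refl) auto
  finally show ?thesis by simp
qed

lemma bit_fps_add_self [simp]: "(f::bit fps) + f = 0"
  by (rule fps_ext) (simp only: fps_add_nth fps_zero_nth bit_double)

text \<open>Frobenius: in the convolution the terms for \<open>i\<close> and \<open>n - i\<close>
  cancel, leaving only \<open>i = n div 2\<close>, where \<open>x * x = x\<close> in
  \<open>bit\<close>.\<close>

lemma bit_fps_square: "(f::bit fps)\<^sup>2 = f oo fps_X\<^sup>2"
proof (rule fps_ext)
  fix n :: nat
  define I where "I = {i\<in>{0..n}. i \<noteq> n - i}"
  have "(\<Sum>i\<in>I. f $ i * f $ (n - i)) = 0"
    by (rule sum_involution_eq_0 [where h = "\<lambda>i. n - i"]) (auto simp: I_def mult.commute)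
  moreover have "f\<^sup>2 $ n = (\<Sum>i\<in>I. f $ i * f $ (n - i)) + (\<Sum>i\<in>{0..n} - I. f $ i * f $ (n - i))"
    unfolding power2_eq_square fps_mult_nth
    by (subst add.commute, rule sum.subset_diff) (auto simp: I_def)
  moreover have "{0..n} - I = (if even n then {n div 2} else {})"
    by (auto simp: I_def; presburger)
  moreover have "x * x = x" for x :: bit by (cases x) auto
  ultimately show "f\<^sup>2 $ n = (f oo fps_X\<^sup>2) $ n"
    by (auto simp: fps_compose_X_power_nth elim!: evenE)
qed

lemma bit_fps_square_nth: "(f::bit fps)\<^sup>2 $ n = (if even n then f $ (n div 2) else 0)"
  by (simp add: bit_fps_square [of f] fps_compose_X_power_nth)

lemma bit_fps_square_add: "((f::bit fps) + g)\<^sup>2 = f\<^sup>2 + g\<^sup>2"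
  by (simp add: bit_fps_square [of f] bit_fps_square [of g] bit_fps_square [of "f + g"] fps_compose_add_distrib)

lemma bit_fps_diff: "(f::bit fps) - g = f + g"
  by (simp add: fps_eq_iff)

section \<open>The series \<open>eta\<close> and its two product identities\<close>

definition eta :: "bit fps" where
  "eta = Abs_fps (\<lambda>m. of_bool (\<exists>a::int. a mod 6 = 1 \<and> a\<^sup>2 = int m))"

lemma F_nth: "F $ m = of_bool (\<exists>n. odd n \<and> m = n\<^sup>2)"
  by (auto simp: F_def intro: odd_pos)

lemma G_compose: "G = F oo fps_X ^ 5"
  by (simp add: fps_eq_iff G_def fps_compose_X_power_nth)

text \<open>The class 1 mod 6 never contains both \<open>a\<close> and \<open>-a\<close>. Hence no
  exponent of \<open>eta\<close> is hit twice, and its 0/1 coefficients really count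
  representations.\<close>

lemma square_inj_mod_6:
  fixes a b :: int
  assumes "a\<^sup>2 = b\<^sup>2" "a mod 6 = 1" "b mod 6 = 1"
  shows "a = b"
proof -
  have "a = b \<or> a = - b" using assms(1) by (simp add: power2_eq_iff)
  then show ?thesis using assms by presburger
qed

text \<open>The convolution index \<open>i\<close> is \<open>a^2\<close>. It determines
  \<open>a\<close>, then \<open>b^2\<close>, then \<open>b\<close>, so nonzero terms correspond to
  solutions one to one.\<close>

lemma eta_mult_nth:
  assumes "k > 0"
  shows "(eta * (eta oo fps_X ^ k)) $ n = 
    par {(a::int, b). a mod 6 = 1 \<and> b mod 6 = 1 \<and> a\<^sup>2 + int k * b\<^sup>2 = int n}"
    (is "_ = par ?P")
proof -
  let ?f = "\<lambda>i. eta $ i * (eta oo fps_X ^ k) $ (n - i)"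
  have nth: "?f i = of_bool (i \<in> (\<lambda>(a, b). nat (a\<^sup>2)) ` ?P)" if "i \<le> n" for i
  proof -
    have "(\<exists>a::int. a mod 6 = 1 \<and> a\<^sup>2 = int i) \<and> k dvd (n - i)
        \<and> (\<exists>b::int. b mod 6 = 1 \<and> b\<^sup>2 = int ((n - i) div k))
      \<longleftrightarrow> i \<in> (\<lambda>(a, b). nat (a\<^sup>2)) ` ?P" (is "?L \<longleftrightarrow> ?R")
    proof
      assume ?L
      then obtain a b :: int where ab: "a mod 6 = 1" "a\<^sup>2 = int i" "k dvd (n - i)" "b mod 6 = 1"
        "b\<^sup>2 = int ((n - i) div k)" by blast
      have "int k * b\<^sup>2 = int (n - i)" using ab by (metis dvd_mult_div_cancel of_nat_mult)
      with ab that have "(a, b) \<in> ?P" by simp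
      moreover have "i = nat (a\<^sup>2)" using ab by simp
      ultimately show ?R by force
    next
      assume ?R
      then obtain a b :: int where ab: "a mod 6 = 1" "b mod 6 = 1" "a\<^sup>2 + int k * b\<^sup>2 = int n" "i = nat (a\<^sup>2)"
        by auto
      have "int (n - i) = int k * b\<^sup>2" using ab that by simp
      also have "\<dots> = int (k * nat (b\<^sup>2))" by simp
      finally have "n - i = k * nat (b\<^sup>2)" by linarith
      moreover have "(n - i) div k = nat (b\<^sup>2)" using assms calculation by simp
      ultimately have "k dvd n - i" "b mod 6 = 1 \<and> b\<^sup>2 = int ((n - i) div k)" using ab by simp_all
      moreover have "a mod 6 = 1 \<and> a\<^sup>2 = int i" using ab by simp
      ultimately show ?L by blast
    qed
    then show ?thesis by (auto simp: eta_def fps_compose_X_power_nth assms)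
  qed
  have "nat (a\<^sup>2) \<le> n" if "a\<^sup>2 + int k * b\<^sup>2 = int n" for a b :: int
  proof -
    have "0 \<le> int k * b\<^sup>2" by simp
    with that show ?thesis by linarith
  qed
  then have sub: "(\<lambda>(a, b). nat (a\<^sup>2)) ` ?P \<subseteq> {0..n}" by auto
  have inj: "inj_on (\<lambda>(a, b). nat (a\<^sup>2)) ?P"
  proof (rule inj_onI, clarify)
    fix a b c d :: int
    assume *: "a mod 6 = 1" "b mod 6 = 1" "c mod 6 = 1" "d mod 6 = 1" "nat (a\<^sup>2) = nat (c\<^sup>2)"
      "a\<^sup>2 + int k * b\<^sup>2 = int n" "c\<^sup>2 + int k * d\<^sup>2 = int n"
    then have "a\<^sup>2 = c\<^sup>2" by (simp add: eq_nat_nat_iff)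
    moreover from this * have "int k * b\<^sup>2 = int k * d\<^sup>2" by linarith
    then have "b\<^sup>2 = d\<^sup>2" using assms by simp
    ultimately show "a = c \<and> b = d" using * by (auto intro: square_inj_mod_6)
  qed
  have "(eta * (eta oo fps_X ^ k)) $ n = (\<Sum>i=0..n. of_bool (i \<in> (\<lambda>(a, b). nat (a\<^sup>2)) ` ?P))"
    unfolding fps_mult_nth by (rule sum.cong) (use nth in auto)
  also have "\<dots> = par ((\<lambda>(a, b). nat (a\<^sup>2)) ` ?P)"
    using sub by (intro sum.mono_neutral_cong_right) auto
  also have "\<dots> = par ?P"
    by (subst sum.reindex [OF inj]) simp
  finally show ?thesis .
qed

text \<open>By Frobenius the left side is \<open>eta ^ 3\<close>. Two numbers that are 1 mod 6
  differ by \<open>6 v\<close>; with \<open>a = b + 6 v\<close> and \<open>c = b + 2 v\<close> the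
  form \<open>a^2 + 2 b^2\<close> equals \<open>3 (c^2 + 8 v^2)\<close>, so only exponents divisible
  by 3 occur and \<open>reps_8\<close> counts them.\<close>

lemma eta_mult_2: "eta * (eta oo fps_X\<^sup>2) = F oo fps_X ^ 3"
proof (rule fps_ext)
  fix n
  let ?P = "{(a::int, b). a mod 6 = 1 \<and> b mod 6 = 1 \<and> a\<^sup>2 + 2 * b\<^sup>2 = int n}"
  have nth: "(eta * (eta oo fps_X\<^sup>2)) $ n = par ?P"
    using eta_mult_nth [of 2 n] by (simp only: of_nat_numeral zero_less_numeral simp_thms)
  show "(eta * (eta oo fps_X\<^sup>2)) $ n = (F oo fps_X ^ 3) $ n"
  proof (cases "3 dvd n")
    case True
    then obtain N where N: "n = 3 * N" by blast
    have "par ?P = par (reps_8 N)"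
    proof (rule par_bij_witness [where i = "\<lambda>(a, b). (b + 2 * ((a - b) div 6), (a - b) div 6)"
          and j = "\<lambda>(c, v). (c + 4 * v, c - 2 * v)"])
      fix p assume "p \<in> ?P"
      then obtain a b where p: "p = (a, b)" "a mod 6 = 1" "b mod 6 = 1" "a\<^sup>2 + 2 * b\<^sup>2 = int n" by auto
      define v where "v = (a - b) div 6"
      have a: "a = b + 6 * v" unfolding v_def using p by presburger
      show "(\<lambda>(c, v). (c + 4 * v, c - 2 * v)) ((\<lambda>(a, b). (b + 2 * ((a - b) div 6), (a - b) div 6)) p) = p"
        by (simp add: p(1) a)
      have "odd (b + 2 * v)" "(b + 2 * v + v) mod 3 = 1" using p by presburger+
      moreover have "(b + 2 * v)\<^sup>2 + 8 * v\<^sup>2 = int N"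
        using p(4) unfolding a N by (simp add: power2_eq_square algebra_simps)
      ultimately show "(\<lambda>(a, b). (b + 2 * ((a - b) div 6), (a - b) div 6)) p \<in> reps_8 N"
        by (simp add: p(1) reps_8_def flip: v_def)
    next
      fix q assume "q \<in> reps_8 N"
      then obtain c v where q: "q = (c, v)" "c\<^sup>2 + 8 * v\<^sup>2 = int N" "odd c" "(c + v) mod 3 = 1"
        by (cases q) (auto simp: reps_8_def)
      show "(\<lambda>(a, b). (b + 2 * ((a - b) div 6), (a - b) div 6)) ((\<lambda>(c, v). (c + 4 * v, c - 2 * v)) q) = q"
        by (simp add: q(1))
      have "(c + 4 * v) mod 6 = 1" "(c - 2 * v) mod 6 = 1" using q by presburger+
      moreover have "(c + 4 * v)\<^sup>2 + 2 * (c - 2 * v)\<^sup>2 = int n"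
        using q(2) unfolding N by (simp add: power2_eq_square algebra_simps)
      ultimately show "(\<lambda>(c, v). (c + 4 * v, c - 2 * v)) q \<in> ?P"
        by (simp add: q(1))
    qed
    then show ?thesis unfolding nth by (simp only: par_reps_8) (simp add: N F_nth fps_compose_X_power_nth)
  next
    case False
    have *: "3 dvd int n" if "a mod 6 = 1" "b mod 6 = 1" "a\<^sup>2 + 2 * b\<^sup>2 = int n" for a b :: int
    proof -
      have "a = b + 6 * ((a - b) div 6)" using that by presburger
      then obtain x where "a = b + 6 * x" by blast
      then have "int n = 3 * (b\<^sup>2 + 4 * b * x + 12 * x\<^sup>2)"
        using that(3) by (simp add: power2_eq_square algebra_simps)
      then show ?thesis by simp
    qed
    have "\<not> 3 dvd int n" using False int_dvd_int_iff [of 3 n] by simp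
    with * have "?P = {}" by blast
    with False show ?thesis unfolding nth by (simp only: sum.empty) (simp add: fps_compose_X_power_nth)
  qed
qed

text \<open>With \<open>a = b + 6 v\<close>, \<open>c = b + v\<close>, \<open>w = -v\<close> the
  form \<open>a^2 + 5 b^2\<close> equals \<open>6 (c^2 + 5 w^2)\<close>, and \<open>reps_5\<close>
  counts the solutions.\<close>

lemma eta_mult_5: "eta * (eta oo fps_X ^ 5) = (F\<^sup>2 + G\<^sup>2) oo fps_X ^ 3"
proof (rule fps_ext)
  fix n
  let ?P = "{(a::int, b). a mod 6 = 1 \<and> b mod 6 = 1 \<and> a\<^sup>2 + 5 * b\<^sup>2 = int n}"
  have nth: "(eta * (eta oo fps_X ^ 5)) $ n = par ?P"
    using eta_mult_nth [of 5 n] by (simp only: of_nat_numeral zero_less_numeral simp_thms)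
  \<comment> \<open>Squaring doubles exponents and the substitution triples them, hence the index
    \<open>n div 6\<close>.\<close>
  have R: "((F\<^sup>2 + G\<^sup>2) oo fps_X ^ 3) $ n = 
    (if 6 dvd n then of_bool (\<exists>m. odd m \<and> n div 6 = m\<^sup>2) + of_bool (\<exists>m. odd m \<and> n div 6 = 5 * m\<^sup>2) else 0)"
  proof -
    have "G $ m = of_bool (\<exists>n. odd n \<and> m = 5 * n\<^sup>2)" for m
    proof -
      have "5 dvd m \<and> (\<exists>n. odd n \<and> m div 5 = n\<^sup>2) \<longleftrightarrow> (\<exists>n. odd n \<and> m = 5 * n\<^sup>2)"
        by (metis dvd_mult_div_cancel dvd_triv_left nonzero_mult_div_cancel_left zero_neq_numeral)
      moreover have "G $ m = of_bool (5 dvd m \<and> (\<exists>n. odd n \<and> m div 5 = n\<^sup>2))"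
        by (simp add: G_compose F_nth fps_compose_X_power_nth)
      ultimately show ?thesis by (simp only:)
    qed
    moreover have "6 dvd n \<longleftrightarrow> 3 dvd n \<and> even (n div 3)"
      using nat_mult_dvd_cancel_disj [of 3 2] by (auto elim!: dvdE)
    moreover have "n div 6 = n div 3 div 2" by (simp add: div_mult2_eq [symmetric])
    ultimately show ?thesis
      by (simp add: fps_compose_X_power_nth bit_fps_square_nth F_nth)
  qed
  show "(eta * (eta oo fps_X ^ 5)) $ n = ((F\<^sup>2 + G\<^sup>2) oo fps_X ^ 3) $ n"
  proof (cases "6 dvd n")
    case True
    then obtain N where N: "n = 6 * N" by blast
    have "par ?P = par (reps_5 N)"
    proof (rule par_bij_witness [where i = "\<lambda>(a, b). (b + (a - b) div 6, - ((a - b) div 6))"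
          and j = "\<lambda>(c, w). (c - 5 * w, c + w)"])
      fix p assume "p \<in> ?P"
      then obtain a b where p: "p = (a, b)" "a mod 6 = 1" "b mod 6 = 1" "a\<^sup>2 + 5 * b\<^sup>2 = int n" by auto
      define v where "v = (a - b) div 6"
      have a: "a = b + 6 * v" unfolding v_def using p by presburger
      show "(\<lambda>(c, w). (c - 5 * w, c + w)) ((\<lambda>(a, b). (b + (a - b) div 6, - ((a - b) div 6))) p) = p"
        by (simp add: p(1) a)
      have "odd (b + v + - v)" "(b + v + - v) mod 3 = 1" using p by presburger+
      moreover have "(b + v)\<^sup>2 + 5 * (- v)\<^sup>2 = int N"
        using p(4) unfolding a N by (simp add: power2_eq_square algebra_simps)
      ultimately show "(\<lambda>(a, b). (b + (a - b) div 6, - ((a - b) div 6))) p \<in> reps_5 N"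
        by (simp add: p(1) reps_5_def flip: v_def)
    next
      fix q assume "q \<in> reps_5 N"
      then obtain c w where q: "q = (c, w)" "c\<^sup>2 + 5 * w\<^sup>2 = int N" "odd (c + w)" "(c + w) mod 3 = 1"
        by (cases q) (auto simp: reps_5_def)
      have "(c - 5 * w - (c + w)) div 6 = (6 * (- w)) div 6" by (simp add: algebra_simps)
      also have "\<dots> = - w" by (rule nonzero_mult_div_cancel_left) simp
      finally show "(\<lambda>(a, b). (b + (a - b) div 6, - ((a - b) div 6))) ((\<lambda>(c, w). (c - 5 * w, c + w)) q) = q"
        by (simp only: q(1) prod.case) simp
      have "x mod 6 = 1" if "odd x" "x mod 3 = 1" for x :: int using that by presburger
      then have "(c + w) mod 6 = 1" using q by blast
      moreover have "c - 5 * w = c + w + (- w) * 6" by simp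
      then have "(c - 5 * w) mod 6 = (c + w) mod 6" by (simp only: mod_mult_self1)
      moreover have "(c - 5 * w)\<^sup>2 + 5 * (c + w)\<^sup>2 = int n"
        using q(2) unfolding N by (simp add: power2_eq_square algebra_simps)
      ultimately show "(\<lambda>(c, w). (c - 5 * w, c + w)) q \<in> ?P"
        by (simp add: q(1))
    qed
    then show ?thesis unfolding nth R by (simp only: par_reps_5) (simp add: N)
  next
    case False
    have *: "6 dvd int n" if "a mod 6 = 1" "b mod 6 = 1" "a\<^sup>2 + 5 * b\<^sup>2 = int n" for a b :: int
    proof -
      have "a = b + 6 * ((a - b) div 6)" using that by presburger
      then obtain x where "a = b + 6 * x" by blast
      then have "int n = 6 * (b\<^sup>2 + 2 * b * x + 6 * x\<^sup>2)"
        using that(3) by (simp add: power2_eq_square algebra_simps)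
      then show ?thesis by simp
    qed
    have "\<not> 6 dvd int n" using False int_dvd_int_iff [of 6 n] by simp
    with * have "?P = {}" by blast
    with False show ?thesis unfolding nth R by (simp only: sum.empty if_False)
  qed
qed

lemma modular_equation: "(F + G) ^ 6 = F * G"
proof -
  have dist: "(f * g) oo fps_X ^ k = (f oo fps_X ^ k) * (g oo fps_X ^ k)" if "k > 0" for f g :: "bit fps" and k
    by (rule fps_compose_mult_distrib) (use that in auto)
  have pow: "f ^ m oo fps_X ^ k = (f oo fps_X ^ k) ^ m" if "k > 0" for f :: "bit fps" and k m
    by (rule fps_compose_power [symmetric]) (use that in auto)
  have comm: "(f oo fps_X ^ j) oo fps_X ^ k = (f oo fps_X ^ k) oo fps_X ^ j" if "j > 0" "k > 0" for f :: "bit fps" and j k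
    using that by (simp add: fps_compose_assoc [symmetric] fps_X_power_compose mult.commute flip: power_mult)
  have F: "eta ^ 3 = F oo fps_X ^ 3"
    using eta_mult_2 unfolding bit_fps_square [symmetric] by (simp add: power3_eq_cube power2_eq_square mult.assoc)
  have "(eta oo fps_X ^ 5) ^ 3 = eta ^ 3 oo fps_X ^ 5" by (simp add: pow)
  also have "\<dots> = G oo fps_X ^ 3" unfolding F G_compose by (rule comm) auto
  finally have G: "(eta oo fps_X ^ 5) ^ 3 = G oo fps_X ^ 3" .
  have "(F + G) ^ 6 oo fps_X ^ 3 = ((F\<^sup>2 + G\<^sup>2) oo fps_X ^ 3) ^ 3"
    by (simp add: bit_fps_square_add [symmetric] pow flip: power_mult)
  also have "\<dots> = (F * G) oo fps_X ^ 3"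
    by (simp add: eta_mult_5 [symmetric] power_mult_distrib F G dist)
  \<comment> \<open>Reading off the coefficients at multiples of 3 undoes the substitution of
    \<open>fps_X ^ 3\<close>.\<close>
  finally have "((F + G) ^ 6 oo fps_X ^ 3) $ (3 * n) = ((F * G) oo fps_X ^ 3) $ (3 * n)" for n by simp
  then show ?thesis by (simp add: fps_eq_iff fps_compose_X_power_nth)
qed

text \<open>Multiply \<open>modular_equation\<close> by \<open>(F + G)^2\<close> and expand the
  eighth power by Frobenius. The point is that \<open>F ^ 3\<close> becomes accessible to
  \<open>pr\<close> through an eighth power and powers of \<open>G\<close>.\<close>

lemma F_pow_8: "F ^ 8 = (F ^ 3 + F * G\<^sup>2 + G ^ 7) * G"
proof -
  have "(F + G) ^ 8 = (F + G) ^ 6 * (F + G)\<^sup>2" by (simp flip: power_add)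
  then have "(F + G) ^ 8 = F * G * (F\<^sup>2 + G\<^sup>2)" by (simp only: modular_equation bit_fps_square_add)
  moreover have "(F + G) ^ 8 = (((F + G)\<^sup>2)\<^sup>2)\<^sup>2" by simp
  then have "(F + G) ^ 8 = F ^ 8 + G ^ 8" by (simp only: bit_fps_square_add) simp
  ultimately have "F ^ 8 + G ^ 8 + G ^ 8 = F * G * (F\<^sup>2 + G\<^sup>2) + G ^ 8" by simp
  then show ?thesis by (simp add: add.assoc algebra_simps eval_nat_numeral del: mult_2 mult_2_right)
qed

subsection \<open>The projection and the span\<close>

lemma coprime_5_iff: "coprime n 5 \<longleftrightarrow> \<not> 5 dvd (n::nat)"
  using prime_imp_coprime_nat [of 5 n] coprime_commute [of n 5] not_coprimeI [of 5 n 5] by auto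

lemma coprime_10_iff: "coprime n 10 \<longleftrightarrow> odd n \<and> \<not> 5 dvd (n::nat)"
  using coprime_mult_right_iff [of n 2 5] by (simp add: coprime_5_iff)

lemma pr_nth: "pr f $ n = (if 5 dvd n then 0 else f $ n)"
  by (simp add: pr_def coprime_5_iff)

lemma pr_add: "pr (f + g) = pr f + pr g"
  by (simp add: fps_eq_iff pr_nth)

text \<open>A series in \<open>fps_X ^ 5\<close> moves exponents by multiples of 5 only, so
  divisibility of an exponent by 5 is unaffected. Everything built from \<open>G\<close> is such a
  series.\<close>

lemma pr_mult_compose: "pr (f * (h oo fps_X ^ 5)) = pr f * (h oo fps_X ^ 5)"
proof (rule fps_ext)
  fix n :: nat
  have "5 dvd n \<longleftrightarrow> 5 dvd i" if "i \<le> n" "5 dvd n - i" for i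
    using that by (metis dvd_diffD dvd_diffD1)
  then have *: "(pr f * (h oo fps_X ^ 5)) $ n =
      (\<Sum>i=0..n. if 5 dvd n then 0 else f $ i * (h oo fps_X ^ 5) $ (n - i))"
    unfolding fps_mult_nth by (intro sum.cong refl) (auto simp: pr_nth fps_compose_X_power_nth)
  show "pr (f * (h oo fps_X ^ 5)) $ n = (pr f * (h oo fps_X ^ 5)) $ n"
    unfolding * by (cases "5 dvd n") (simp_all add: pr_nth fps_mult_nth)
qed

text \<open>Squaring doubles exponents, and 2 is prime to 5.\<close>

lemma pr_square: "pr (f\<^sup>2) = (pr f)\<^sup>2"
proof (rule fps_ext)
  fix n :: nat
  have "5 dvd n \<longleftrightarrow> 5 dvd n div 2" if "even n" using that by presburger
  then show "pr (f\<^sup>2) $ n = (pr f)\<^sup>2 $ n"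
    by (auto simp: pr_nth bit_fps_square_nth)
qed

lemma pr_1: "pr 1 = 0"
  by (simp add: fps_eq_iff pr_nth)

lemma G_power_compose: "G ^ m = F ^ m oo fps_X ^ 5"
  by (simp add: G_compose fps_compose_power)

lemma pr_mult_G_power: "pr (f * G ^ m) = pr f * G ^ m"
  by (simp add: G_power_compose pr_mult_compose)

lemma pr_G_power: "pr (G ^ m) = 0"
  using pr_mult_G_power [of 1 m] by (simp add: pr_1)

lemma pr_F: "pr F = D"
proof (rule fps_ext)
  fix m :: nat
have "5 dvd n\<^sup>2 \<longleftrightarrow> 5 dvd n" for n :: nat
    by (rule prime_dvd_power_iff) auto
  then have "(\<exists>n>0. coprime n 10 \<and> m = n\<^sup>2) \<longleftrightarrow> \<not> 5 dvd m \<and> (\<exists>n. odd n \<and> m = n\<^sup>2)"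
    by (metis coprime_10_iff odd_pos)
  then show "pr F $ m = D $ m"
    by (simp add: pr_nth F_nth D_def)
qed

lemma G_nonzero: "G \<noteq> 0"
proof
  assume "G = 0"
  moreover have "G $ 5 = 1" by (auto simp: G_compose fps_compose_X_power_nth F_nth intro: exI [of _ 1])
  ultimately show False by simp
qed

text \<open>Apply \<open>pr\<close> to \<open>F_pow_8\<close>: the left side becomes
  \<open>D ^ 8\<close>, the power of \<open>G\<close> is killed, and \<open>G\<close> can be
  cancelled.\<close>

lemma pr_F_cubed: "pr (F ^ 3) = Dbase 3 + G\<^sup>2 * D"
proof -
  have "pr (F ^ 8) = pr (F ^ 3 + F * G\<^sup>2 + G ^ 7) * G"
    unfolding F_pow_8 using pr_mult_G_power [of _ 1] by simp
  also have "\<dots> = (pr (F ^ 3) + G\<^sup>2 * D) * G"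
    by (simp only: pr_add pr_mult_G_power pr_G_power pr_F add_0_right mult.commute [of D])
  also have "pr (F ^ 8) = D ^ 8"
    using pr_square [of "F ^ 4"] pr_square [of "F\<^sup>2"] pr_square [of F] by (simp add: pr_F)
  finally have "D ^ 8 / G = pr (F ^ 3) + G\<^sup>2 * D"
    using G_nonzero by simp
  then show ?thesis by (simp add: Dbase_def add.assoc)
qed

section \<open>Orders and independence of the \<open>Dk\<close>\<close>

lemma Kset_iff: "k \<in> Kset \<longleftrightarrow> k mod 10 \<in> {1, 3, 7, 9}"
proof -
  have "k > 0 \<and> odd k \<and> \<not> 5 dvd k \<longleftrightarrow> k mod 10 = 1 \<or> k mod 10 = 3 \<or> k mod 10 = 7 \<or> k mod 10 = 9"
    by presburger
  then show ?thesis by (simp add: Kset_def coprime_10_iff)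
qed

lemma subdegree_G: "subdegree G = 5"
  by (rule subdegreeI) (auto simp: G_compose fps_compose_X_power_nth F_nth elim!: dvdE intro: exI [of _ 1])

lemma subdegree_D: "subdegree D = 1"
  by (rule subdegreeI) (auto simp: D_def intro: exI [of _ 1])

text \<open>With \<open>D\<close> of order 1 and \<open>G\<close> of order 5, the orders are 1, 8 -
  5, 2 + 5 and 4 + 5.\<close>

lemma subdegree_Dbase:
  assumes "r \<in> {1, 3, 7, 9}"
  shows "Dbase r \<noteq> 0 \<and> subdegree (Dbase r) = r"
proof -
  have [simp]: "D \<noteq> 0" using subdegree_D by auto
  \<comment> \<open>The order of a quotient is the difference of orders once the division is exact,
    which follows from 5 \<le> 8.\<close>
  have "G dvd D ^ 8"
    by (simp add: fps_dvd_iff G_nonzero subdegree_G subdegree_D)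
  then have "D ^ 8 / G * G = D ^ 8" by simp
  moreover from this have "D ^ 8 / G \<noteq> 0" by auto
  ultimately have "D ^ 8 / G \<noteq> 0 \<and> subdegree (D ^ 8 / G) + subdegree G = subdegree (D ^ 8)"
    using G_nonzero by (metis subdegree_mult)
  then show ?thesis
    using assms G_nonzero by (auto simp: Dbase_def subdegree_G subdegree_D)
qed

text \<open>\<open>G\<^sup>2\<close> has order 10, so the order is
  \<open>10 * (k div 10) + k mod 10\<close>.\<close>

lemma subdegree_Dk:
  assumes "k \<in> Kset"
  shows "Dk k \<noteq> 0 \<and> subdegree (Dk k) = k"
  using subdegree_Dbase [of "k mod 10"] assms G_nonzero
  by (simp add: Dk_def Kset_iff subdegree_G)

text \<open>At the least index \<open>m\<close> with \<open>c m\<close> nonzero, the coefficient of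
  degree \<open>m\<close> in the sum comes from \<open>Dk m\<close> alone, since all other surviving
  terms have larger order.\<close>

lemma Dk_linear_independent:
  assumes "finite S" "S \<subseteq> Kset" "(\<Sum>k\<in>S. fps_const (c k) * Dk k) = 0" "k \<in> S"
  shows "c k = 0"
proof (rule ccontr)
  assume "c k \<noteq> 0"
  define T where "T = {k\<in>S. c k \<noteq> 0}"
  define m where "m = Min T"
  have T: "finite T" "T \<noteq> {}" using assms(1,4) \<open>c k \<noteq> 0\<close> by (auto simp: T_def)
  then have m: "m \<in> T" "\<And>j. j \<in> T \<Longrightarrow> m \<le> j" by (auto simp: m_def)
  have "fps_const (c j) * Dk j = 0 \<or> j > m" if "j \<in> S - {m}" for j
    using that m(2) [of j] by (auto simp: T_def)
  then have "(fps_const (c j) * Dk j) $ m = 0" if "j \<in> S - {m}" for j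
    using that subdegree_Dk [of j] assms(2) nth_less_subdegree_zero [of m "Dk j"] by fastforce
  then have "(\<Sum>k\<in>S - {m}. (fps_const (c k) * Dk k) $ m) = 0"
    by (intro sum.neutral) blast
  then have "(\<Sum>k\<in>S. fps_const (c k) * Dk k) $ m = (fps_const (c m) * Dk m) $ m"
    using m(1) assms(1) by (simp only: fps_sum_nth) (subst sum.remove [of S m], auto simp: T_def)
  moreover have "Dk m $ m \<noteq> 0"
    using subdegree_Dk [of m] m(1) assms(2) nth_subdegree_nonzero [of "Dk m"]
    unfolding T_def by (metis (no_types, lifting) mem_Collect_eq subsetD)
  ultimately show False using assms(3) m(1) by (simp add: T_def)
qed

section \<open>Coordinates over Z/2[G^2]\<close>

lemma sum_Dk_blocks:
  "(\<Sum>k\<in>Kset \<inter> {..<10 * n}. fps_const (c k) * Dk k) =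
    (\<Sum>r\<in>{1, 3, 7, 9}. (\<Sum>i<n. fps_const (c (10 * i + r)) * (G\<^sup>2) ^ i) * Dbase r)"
proof (induction n)
  case (Suc n)
  let ?R = "{1, 3, 7, 9} :: nat set"
  \<comment> \<open>Passing from \<open>n\<close> to \<open>Suc n\<close> adds the four indices
    \<open>10 * n + r\<close>, where \<open>Dk\<close> is
    \<open>(G\<^sup>2) ^ n * Dbase r\<close>.\<close>
  have "Kset \<inter> {..<10 * Suc n} = Kset \<inter> {..<10 * n} \<union> (\<lambda>r. 10 * n + r) ` ?R"
  proof (intro equalityI subsetI)
    fix k assume k: "k \<in> Kset \<inter> {..<10 * Suc n}"
    show "k \<in> Kset \<inter> {..<10 * n} \<union> (\<lambda>r. 10 * n + r) ` ?R"
    proof (cases "k < 10 * n")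
      case False
      then have "k div 10 = n" using k by auto
      then have "k = 10 * n + k mod 10" by (metis mult_div_mod_eq)
      with k show ?thesis unfolding Kset_iff Int_iff by blast
    qed (use k in simp)
  qed (auto simp: Kset_iff)
  then have "(\<Sum>k\<in>Kset \<inter> {..<10 * Suc n}. fps_const (c k) * Dk k) =
    (\<Sum>k\<in>Kset \<inter> {..<10 * n}. fps_const (c k) * Dk k)
    + (\<Sum>k\<in>(\<lambda>r. 10 * n + r) ` ?R. fps_const (c k) * Dk k)"
    by (simp only:) (rule sum.union_disjoint, auto)
  also have "(\<Sum>k\<in>(\<lambda>r. 10 * n + r) ` ?R. fps_const (c k) * Dk k)
    = (\<Sum>r\<in>?R. fps_const (c (10 * n + r)) * (G\<^sup>2) ^ n * Dbase r)"
    by (subst sum.reindex) (auto simp: Dk_def mult.assoc intro!: sum.cong)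
  finally show ?case
    by (simp only: Suc.IH sum.lessThan_Suc distrib_right sum.distrib)
qed simp

text \<open>Coefficients are padded with 0, so that several elements can be written with one common
  length.\<close>

lemma ZG2_E:
  assumes "a \<in> ZG2"
  obtains c N where "\<And>n. n \<ge> N \<Longrightarrow> a = (\<Sum>i<n. fps_const (c i) * (G\<^sup>2) ^ i)"
proof -
  obtain c N where a: "a = (\<Sum>i<N. fps_const (c i) * (G\<^sup>2) ^ i)"
    using assms by (auto simp: ZG2_def)
  have "a = (\<Sum>i<n. fps_const (if i < N then c i else 0) * (G\<^sup>2) ^ i)" if "n \<ge> N" for n
    unfolding a using that by (intro sum.mono_neutral_cong_left) auto
  then show thesis using that [of N "\<lambda>i. if i < N then c i else 0"] by blast
qed

lemma ZG2_I: "(\<Sum>i<n. fps_const (c i) * (G\<^sup>2) ^ i) \<in> ZG2"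
  by (auto simp: ZG2_def)

lemma ZG2_add:
  assumes "a \<in> ZG2" "b \<in> ZG2"
  shows "a + b \<in> ZG2"
proof -
  obtain c N where a: "\<And>n. n \<ge> N \<Longrightarrow> a = (\<Sum>i<n. fps_const (c i) * (G\<^sup>2) ^ i)"
    using assms(1) by (rule ZG2_E) blast
  obtain d M where b: "\<And>n. n \<ge> M \<Longrightarrow> b = (\<Sum>i<n. fps_const (d i) * (G\<^sup>2) ^ i)"
    using assms(2) by (rule ZG2_E) blast
  have "a + b = (\<Sum>i<max N M. fps_const (c i + d i) * (G\<^sup>2) ^ i)"
    using a [of "max N M"] b [of "max N M"]
    by (simp add: sum.distrib algebra_simps flip: fps_const_add)
  then show ?thesis using ZG2_I by metis
qed

lemma ZG2_mult_G_square:
  assumes "a \<in> ZG2"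
  shows "a * G\<^sup>2 \<in> ZG2"
proof -
  obtain c n where a: "a = (\<Sum>i<n. fps_const (c i) * (G\<^sup>2) ^ i)"
    using assms by (auto simp: ZG2_def)
  have "a * G\<^sup>2 = (\<Sum>i<Suc n. fps_const (if i = 0 then 0 else c (i - 1)) * (G\<^sup>2) ^ i)"
    unfolding a sum.lessThan_Suc_shift by (simp add: sum_distrib_right sum_distrib_left algebra_simps)
  then show ?thesis using ZG2_I by metis
qed

lemma pr_mult_ZG2:
  assumes "a \<in> ZG2"
  shows "pr (a * f) = a * pr f"
proof -
  obtain c n where a: "a = (\<Sum>i<n. fps_const (c i) * (G\<^sup>2) ^ i)"
    using assms by (auto simp: ZG2_def)
  \<comment> \<open>Exhibits \<open>a\<close> as a series in \<open>fps_X ^ 5\<close>, so that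
    \<open>pr_mult_compose\<close> applies.\<close>
  have "a = (\<Sum>i<n. fps_const (c i) * (F\<^sup>2) ^ i) oo fps_X ^ 5"
    unfolding a fps_compose_sum_distrib
    by (intro sum.cong refl) (simp add: fps_compose_mult_distrib G_power_compose fps_compose_power)
  then show ?thesis using pr_mult_compose [of f] by (simp add: mult.commute)
qed

text \<open>Interleaves four coefficient sequences into one, by residue mod 10; the converse of
  reading \<open>sum_Dk_blocks\<close> from left to right.\<close>

lemma quadruple_as_sum_Dk:
  assumes "p1 \<in> ZG2" "p3 \<in> ZG2" "p7 \<in> ZG2" "p9 \<in> ZG2"
  obtains c n where
    "p1 * Dbase 1 + p3 * Dbase 3 + p7 * Dbase 7 + p9 * Dbase 9
      = (\<Sum>k\<in>Kset \<inter> {..<10 * n}. fps_const (c k) * Dk k)"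
    "p1 = (\<Sum>i<n. fps_const (c (10 * i + 1)) * (G\<^sup>2) ^ i)"
    "p3 = (\<Sum>i<n. fps_const (c (10 * i + 3)) * (G\<^sup>2) ^ i)"
    "p7 = (\<Sum>i<n. fps_const (c (10 * i + 7)) * (G\<^sup>2) ^ i)"
    "p9 = (\<Sum>i<n. fps_const (c (10 * i + 9)) * (G\<^sup>2) ^ i)"
proof -
  obtain c1 N1 where 1: "\<And>n. n \<ge> N1 \<Longrightarrow> p1 = (\<Sum>i<n. fps_const (c1 i) * (G\<^sup>2) ^ i)"
    using assms(1) by (rule ZG2_E) blast
  obtain c3 N3 where 3: "\<And>n. n \<ge> N3 \<Longrightarrow> p3 = (\<Sum>i<n. fps_const (c3 i) * (G\<^sup>2) ^ i)"
    using assms(2) by (rule ZG2_E) blast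
  obtain c7 N7 where 7: "\<And>n. n \<ge> N7 \<Longrightarrow> p7 = (\<Sum>i<n. fps_const (c7 i) * (G\<^sup>2) ^ i)"
    using assms(3) by (rule ZG2_E) blast
  obtain c9 N9 where 9: "\<And>n. n \<ge> N9 \<Longrightarrow> p9 = (\<Sum>i<n. fps_const (c9 i) * (G\<^sup>2) ^ i)"
    using assms(4) by (rule ZG2_E) blast
  define n where "n = N1 + N3 + N7 + N9"
  \<comment> \<open>The last branch serves residue 9; the remaining residues lie outside
    \<open>Kset\<close>.\<close>
  define c where "c k = (if k mod 10 = 1 then c1 else if k mod 10 = 3 then c3
    else if k mod 10 = 7 then c7 else c9) (k div 10)" for k
  have c: "c (10 * i + 1) = c1 i" "c (10 * i + 3) = c3 i" "c (10 * i + 7) = c7 i" "c (10 * i + 9) = c9 i" for i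
  proof -
    have *: "(10 * i + r) mod 10 = r" "(10 * i + r) div 10 = i" if "r < 10" for r using that by simp_all
    have "(10 * i + 1) mod 10 = 1" "(10 * i + 3) mod 10 = 3" "(10 * i + 7) mod 10 = 7" "(10 * i + 9) mod 10 = 9"
      "(10 * i + 1) div 10 = i" "(10 * i + 3) div 10 = i" "(10 * i + 7) div 10 = i" "(10 * i + 9) div 10 = i"
      by (rule *, simp)+
    then show "c (10 * i + 1) = c1 i" "c (10 * i + 3) = c3 i" "c (10 * i + 7) = c7 i" "c (10 * i + 9) = c9 i"
      unfolding c_def by (simp_all only:) simp_all
  qed
  have p: "p1 = (\<Sum>i<n. fps_const (c (10 * i + 1)) * (G\<^sup>2) ^ i)"
    "p3 = (\<Sum>i<n. fps_const (c (10 * i + 3)) * (G\<^sup>2) ^ i)"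
    "p7 = (\<Sum>i<n. fps_const (c (10 * i + 7)) * (G\<^sup>2) ^ i)"
    "p9 = (\<Sum>i<n. fps_const (c (10 * i + 9)) * (G\<^sup>2) ^ i)"
    unfolding c by (rule 1 3 7 9, simp add: n_def)+
  show thesis
  proof (rule that [OF _ p])
    show "p1 * Dbase 1 + p3 * Dbase 3 + p7 * Dbase 7 + p9 * Dbase 9
      = (\<Sum>k\<in>Kset \<inter> {..<10 * n}. fps_const (c k) * Dk k)"
      unfolding p sum_Dk_blocks by (simp add: add.assoc)
  qed
qed

text \<open>Regroups the span as the Z/2[G^2]-module on four generators, the shape in which
  \<open>pr_N2_element\<close> delivers its values.\<close>

lemma W_eq:
  "W = {p1 * Dbase 1 + p3 * Dbase 3 + p7 * Dbase 7 + p9 * Dbase 9 | p1 p3 p7 p9.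
    p1 \<in> ZG2 \<and> p3 \<in> ZG2 \<and> p7 \<in> ZG2 \<and> p9 \<in> ZG2}" (is "_ = ?V")
proof (intro equalityI subsetI)
  fix f assume "f \<in> W"
  then obtain S c where f: "f = (\<Sum>k\<in>S. fps_const (c k) * Dk k)" and S: "finite S" "S \<subseteq> Kset"
    by (auto simp: W_def)
  obtain n where n: "\<And>k. k \<in> S \<Longrightarrow> k < n"
    using S(1) finite_nat_set_iff_bounded by metis
  define d where "d k = (if k \<in> S then c k else 0)" for k
  have "f = (\<Sum>k\<in>Kset \<inter> {..<10 * n}. fps_const (d k) * Dk k)"
    unfolding f d_def using S by (intro sum.mono_neutral_cong_left) (auto dest: n)
  then have "f = (\<Sum>i<n. fps_const (d (10 * i + 1)) * (G\<^sup>2) ^ i) * Dbase 1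
    + (\<Sum>i<n. fps_const (d (10 * i + 3)) * (G\<^sup>2) ^ i) * Dbase 3
    + (\<Sum>i<n. fps_const (d (10 * i + 7)) * (G\<^sup>2) ^ i) * Dbase 7
    + (\<Sum>i<n. fps_const (d (10 * i + 9)) * (G\<^sup>2) ^ i) * Dbase 9"
    unfolding sum_Dk_blocks by (simp add: add.assoc)
  then show "f \<in> ?V"
    by (intro CollectI exI conjI) (assumption | rule ZG2_I)+
next
  fix f assume "f \<in> ?V"
  then obtain p1 p3 p7 p9 where f: "f = p1 * Dbase 1 + p3 * Dbase 3 + p7 * Dbase 7 + p9 * Dbase 9"
    and p: "p1 \<in> ZG2" "p3 \<in> ZG2" "p7 \<in> ZG2" "p9 \<in> ZG2" by blast
  from p obtain c n where "f = (\<Sum>k\<in>Kset \<inter> {..<10 * n}. fps_const (c k) * Dk k)"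
    unfolding f by (rule quadruple_as_sum_Dk) blast
  moreover have "finite (Kset \<inter> {..<10 * n})" by simp
  ultimately show "f \<in> W" unfolding W_def by blast
qed

text \<open>Freeness of that module: the interleaved coefficients vanish by
  \<open>Dk_linear_independent\<close>.\<close>

lemma Dbase_independent:
  assumes "p1 * Dbase 1 + p3 * Dbase 3 + p7 * Dbase 7 + p9 * Dbase 9 = 0"
    and p: "p1 \<in> ZG2" "p3 \<in> ZG2" "p7 \<in> ZG2" "p9 \<in> ZG2"
  shows "p1 = 0 \<and> p3 = 0 \<and> p7 = 0 \<and> p9 = 0"
proof -
  obtain c n where eq: "p1 * Dbase 1 + p3 * Dbase 3 + p7 * Dbase 7 + p9 * Dbase 9
      = (\<Sum>k\<in>Kset \<inter> {..<10 * n}. fps_const (c k) * Dk k)"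
    and p_eq: "p1 = (\<Sum>i<n. fps_const (c (10 * i + 1)) * (G\<^sup>2) ^ i)"
    "p3 = (\<Sum>i<n. fps_const (c (10 * i + 3)) * (G\<^sup>2) ^ i)"
    "p7 = (\<Sum>i<n. fps_const (c (10 * i + 7)) * (G\<^sup>2) ^ i)"
    "p9 = (\<Sum>i<n. fps_const (c (10 * i + 9)) * (G\<^sup>2) ^ i)"
    using quadruple_as_sum_Dk [OF p] by blast
  have c: "c k = 0" if "k \<in> Kset" "k < 10 * n" for k
    by (rule Dk_linear_independent [of "Kset \<inter> {..<10 * n}"]) (use that eq assms(1) in auto)
  have "(\<Sum>i<n. fps_const (c (10 * i + r)) * (G\<^sup>2) ^ i) = 0" if "r \<in> {1, 3, 7, 9}" for r
    by (rule sum.neutral) (use that in \<open>auto simp: c Kset_iff\<close>)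
  then show ?thesis unfolding p_eq by blast
qed

text \<open>\<open>F ^ 3\<close> contributes to both \<open>Dbase 3\<close> and
  \<open>Dbase 1\<close>, so the coordinate change is triangular, hence invertible; \<open>a\<close>
  disappears because \<open>pr\<close> kills \<open>G\<close>.\<close>

lemma pr_N2_element:
  assumes "a \<in> ZG2" "b \<in> ZG2" "c \<in> ZG2" "d \<in> ZG2" "e \<in> ZG2"
  shows "pr (a * G + b * F + c * (F\<^sup>2 * G) + d * F ^ 3 + e * (F ^ 4 * G))
    = (b + d * G\<^sup>2) * Dbase 1 + d * Dbase 3 + c * Dbase 7 + e * Dbase 9"
proof -
  have "pr G = 0" "pr (F\<^sup>2 * G) = D\<^sup>2 * G" "pr (F ^ 4 * G) = D ^ 4 * G"
    using pr_G_power [of 1] pr_mult_G_power [of _ 1] pr_square [of F] pr_square [of "F\<^sup>2"]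
    by (simp_all add: pr_F)
  then show ?thesis
    using assms by (simp only: pr_add pr_mult_ZG2 pr_F pr_F_cubed) (simp add: Dbase_def algebra_simps)
qed

text \<open>The bijection on the quotient is expressed without forming it: the image is all of
  \<open>W\<close>, and the fibres of \<open>pr\<close> on \<open>N2\<close> are exactly the classes
  mod \<open>N1\<close>.\<close>

theorem theorem2p7:
  shows "(\<forall>S c. finite S \<and> S \<subseteq> Kset \<and> (\<Sum>k\<in>S. fps_const (c k) * Dk k) = 0
            \<longrightarrow> (\<forall>k\<in>S. c k = (0::bit)))
       \<and> pr ` N2 = W
       \<and> (\<forall>f\<in>N2. \<forall>g\<in>N2. pr f = pr g \<longleftrightarrow> f - g \<in> N1)"
proof (intro conjI)
  show "\<forall>S c. finite S \<and> S \<subseteq> Kset \<and> (\<Sum>k\<in>S. fps_const (c k) * Dk k) = 0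
            \<longrightarrow> (\<forall>k\<in>S. c k = (0::bit))"
    using Dk_linear_independent by blast
  show "pr ` N2 = W"
  proof (intro equalityI subsetI)
    fix f assume "f \<in> pr ` N2"
    then obtain a b c d e where z: "a \<in> ZG2" "b \<in> ZG2" "c \<in> ZG2" "d \<in> ZG2" "e \<in> ZG2"
      and f: "f = pr (a * G + b * F + c * (F\<^sup>2 * G) + d * F ^ 3 + e * (F ^ 4 * G))"
      by (auto simp: N2_def)
    have "b + d * G\<^sup>2 \<in> ZG2" using z by (simp add: ZG2_add ZG2_mult_G_square)
    then show "f \<in> W" unfolding f pr_N2_element [OF z] W_eq using z by blast
  next
    fix f assume "f \<in> W"
    then obtain p1 p3 p7 p9 where f: "f = p1 * Dbase 1 + p3 * Dbase 3 + p7 * Dbase 7 + p9 * Dbase 9"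
      and p: "p1 \<in> ZG2" "p3 \<in> ZG2" "p7 \<in> ZG2" "p9 \<in> ZG2" by (auto simp: W_eq)
    \<comment> \<open>Solves the triangular system \<open>b + d * G\<^sup>2 = p1\<close>,
      \<open>d = p3\<close>, with plus for minus in characteristic 2.\<close>
    define b where "b = p1 + p3 * G\<^sup>2"
    have b: "b \<in> ZG2" unfolding b_def using p by (simp add: ZG2_add ZG2_mult_G_square)
    have "b + p3 * G\<^sup>2 = p1" unfolding b_def by (simp only: add.assoc bit_fps_add_self add_0_right)
    \<comment> \<open>The coefficient of \<open>G\<close> can be any element of \<open>ZG2\<close>;
      \<open>p1\<close> is one at hand.\<close>
    then have "f = pr (p1 * G + b * F + p7 * (F\<^sup>2 * G) + p3 * F ^ 3 + p9 * (F ^ 4 * G))"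
      unfolding f by (simp only: pr_N2_element [OF p(1) b p(3,2,4)])
    moreover have "p1 * G + b * F + p7 * (F\<^sup>2 * G) + p3 * F ^ 3 + p9 * (F ^ 4 * G) \<in> N2"
      unfolding N2_def using p b by blast
    ultimately show "f \<in> pr ` N2" by blast
  qed
  show "\<forall>f\<in>N2. \<forall>g\<in>N2. pr f = pr g \<longleftrightarrow> f - g \<in> N1"
  proof (intro ballI)
    fix f g assume "f \<in> N2" "g \<in> N2"
    from \<open>f \<in> N2\<close> obtain a b c d e where
      z: "a \<in> ZG2" "b \<in> ZG2" "c \<in> ZG2" "d \<in> ZG2" "e \<in> ZG2"
      and f: "f = a * G + b * F + c * (F\<^sup>2 * G) + d * F ^ 3 + e * (F ^ 4 * G)"
      unfolding N2_def by blast
    from \<open>g \<in> N2\<close> obtain a' b' c' d' e' where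
      w: "a' \<in> ZG2" "b' \<in> ZG2" "c' \<in> ZG2" "d' \<in> ZG2" "e' \<in> ZG2"
      and g: "g = a' * G + b' * F + c' * (F\<^sup>2 * G) + d' * F ^ 3 + e' * (F ^ 4 * G)"
      unfolding N2_def by blast
    have fg: "f - g = (a + a') * G + (b + b') * F + (c + c') * (F\<^sup>2 * G) + (d + d') * F ^ 3 + (e + e') * (F ^ 4 * G)"
      unfolding bit_fps_diff f g by (simp add: algebra_simps)
    have pr_eq: "pr f = pr g \<longleftrightarrow> pr (f - g) = 0"
      by (metis bit_fps_diff pr_add eq_iff_diff_eq_0)
    note z' = ZG2_add [OF z(1) w(1)] ZG2_add [OF z(2) w(2)] ZG2_add [OF z(3) w(3)]
      ZG2_add [OF z(4) w(4)] ZG2_add [OF z(5) w(5)]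
    show "pr f = pr g \<longleftrightarrow> f - g \<in> N1"
    proof
      assume "pr f = pr g"
      then have "(b + b' + (d + d') * G\<^sup>2) * Dbase 1 + (d + d') * Dbase 3 + (c + c') * Dbase 7 + (e + e') * Dbase 9 = 0"
        unfolding pr_eq unfolding fg pr_N2_element [OF z'] .
      \<comment> \<open>Vanishing of \<open>d + d'\<close>, read off at \<open>Dbase 3\<close>,
        reduces the coordinate at \<open>Dbase 1\<close> to \<open>b + b'\<close>.\<close>
      from Dbase_independent [OF this ZG2_add [OF z'(2) ZG2_mult_G_square [OF z'(4)]] z'(4,3,5)]
      have "b + b' = 0" "c + c' = 0" "d + d' = 0" "e + e' = 0" by auto
      then have "f - g = (a + a') * G" unfolding fg by simp
      then show "f - g \<in> N1" unfolding N1_def using z' by blast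
    next
      assume "f - g \<in> N1"
      then obtain h where "h \<in> ZG2" "f - g = h * G" by (auto simp: N1_def)
      then show "pr f = pr g" unfolding pr_eq using pr_G_power [of 1] by (simp add: pr_mult_ZG2)
    qed
  qed
qed

end
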